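(* Consider the infinite color urn model with colors indexed by $\mathbb{Z}$ associated with the random walk with increments $\{X_j\}_{j\ge1}$, and let $Z_n$ be the color of the $(n+1)$-th selected ball. Assume that $\mathbb{P}(X_1=1)=\mathbb{P}(X_1=-1)=\frac12$. Then, as $n\to\infty$, $$\sup_{x\in\mathcal{L}_n^{(1)}}\left|\sqrt{\log n}\,\mathbb{P}\left(\frac{Z_n}{\sqrt{\log n}}=x\right)-\phi(x)\right|\longrightarrow 0,$$ where $\mathcal{L}_n^{(1)}=\left\{\frac{z}{\sqrt{\log n}}: z\in\mathbb{Z}\right\}$ for $n\ge2$.
   Context: $\{X_j\}_{j\ge1}$ are i.i.d. random variables in $\mathbb{Z}$ with probability mass function $p(u)=\mathbb{P}(X_1=u)$. Urn model: let $R=((p(v-u)))_{u,v\in\mathbb{Z}}$ and let $R_u$ be the $u$-th row of $R$. The initial configuration $U_0=(U_{0,v})_{v\in\mathbb{Z}}$ is a (non-random) probability vector with only finitely many non-zero entries. For $n\ge0$, the color $Z_n\in\mathbb{Z}$ of the $(n+1)$-th selected ball satisfies $\mathbb{P}(Z_n=v\mid U_n,\dots,U_0)=U_{n,v}/(n+1)$, $v\in\mathbb{Z}$, and $U_{n+1}=U_n+R_{Z_n}$, i.e. $U_{n+1,v}=U_{n,v}+p(v-Z_n)$. (So $\sum_v U_{n,v}=n+1$.) $\phi(x)=\frac{1}{\sqrt{2\pi}}e^{-x^2/2}$ is the standard Gaussian density. *)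

theory Defs
  imports "HOL-Probability.Probability"
begin

locale walk_increments = prob_space N
  for N :: "'b measure" and X :: "nat \<Rightarrow> 'b \<Rightarrow> int" +
  assumes indep: "indep_vars (\<lambda>_. count_space UNIV) X {1..}"
    and ident: "j \<ge> 1 \<Longrightarrow>
      distr N (count_space UNIV) (X j) = distr N (count_space UNIV) (X 1)"

definition increment_pmf :: "'b measure \<Rightarrow> (nat \<Rightarrow> 'b \<Rightarrow> int) \<Rightarrow> int \<Rightarrow> real" where
  "increment_pmf N X u = \<P>(\<omega> in N. X 1 \<omega> = u)"

definition replacement :: "(int \<Rightarrow> real) \<Rightarrow> int \<Rightarrow> int \<Rightarrow> real" where
  "replacement p u v = p (v - u)"

text \<open>The sigma-algebra generated by \<open>U 0, \<dots>, U n\<close>, where each \<open>U i\<close> is a random element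
  of the product space of real families indexed by the integers.\<close>

definition urn_history ::
  "'a measure \<Rightarrow> (nat \<Rightarrow> 'a \<Rightarrow> int \<Rightarrow> real) \<Rightarrow> nat \<Rightarrow> 'a measure" where
  "urn_history M U n =
     vimage_algebra (space M) (\<lambda>\<omega>. \<lambda>i\<in>{..n}. U i \<omega>)
       (\<Pi>\<^sub>M i\<in>{..n}. \<Pi>\<^sub>M v\<in>(UNIV :: int set). (borel :: real measure))"

text \<open>\<open>U n \<omega> v\<close> is the weight of colour \<open>v\<close> at time \<open>n\<close> and \<open>Z n \<omega>\<close> is the colour of the
  \<open>(n + 1)\<close>-th selected ball. The conditional law of \<open>Z n\<close> is expressed by conditional
  expectations of indicators. Since \<open>real_cond_exp\<close> is meaningful only for sub-sigma-algebras, \<open>subalgebra_urn_history\<close>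
  shows that \<open>urn_history M U n\<close> is one.\<close>

locale color_urn = prob_space M
  for M :: "'a measure" and p :: "int \<Rightarrow> real" and u\<^sub>0 :: "int \<Rightarrow> real"
    and U :: "nat \<Rightarrow> 'a \<Rightarrow> int \<Rightarrow> real" and Z :: "nat \<Rightarrow> 'a \<Rightarrow> int" +
  assumes init_nonneg: "u\<^sub>0 v \<ge> 0"
    and init_finite: "finite {v. u\<^sub>0 v \<noteq> 0}"
    and init_sum: "(\<Sum>v | u\<^sub>0 v \<noteq> 0. u\<^sub>0 v) = 1"
    and Z_measurable: "Z n \<in> measurable M (count_space UNIV)"
    and U_init: "\<omega> \<in> space M \<Longrightarrow> U 0 \<omega> = u\<^sub>0"
    and U_update: "\<omega> \<in> space M \<Longrightarrow>
      U (Suc n) \<omega> v = U n \<omega> v + replacement p (Z n \<omega>) v"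
    and Z_cond: "AE \<omega> in M.
      real_cond_exp M (urn_history M U n) (indicator {\<omega> \<in> space M. Z n \<omega> = v}) \<omega>
        = U n \<omega> v / (real n + 1)"

lemma (in color_urn) U_component_measurable: "(\<lambda>\<omega>. U n \<omega> v) \<in> borel_measurable M"
proof (induction n)
  case 0
  have "(\<lambda>\<omega>. U 0 \<omega> v) \<in> borel_measurable M \<longleftrightarrow> (\<lambda>_. u\<^sub>0 v) \<in> borel_measurable M"
    by (rule measurable_cong) (simp add: U_init)
  then show ?case by simp
next
  case (Suc n)
  have "(\<lambda>\<omega>. replacement p (Z n \<omega>) v) \<in> borel_measurable M"
    by (rule measurable_compose[OF Z_measurable]) simp
  then have "(\<lambda>\<omega>. U n \<omega> v + replacement p (Z n \<omega>) v) \<in> borel_measurable M"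
    using Suc by (intro borel_measurable_add)
  moreover have "(\<lambda>\<omega>. U (Suc n) \<omega> v) \<in> borel_measurable M \<longleftrightarrow>
      (\<lambda>\<omega>. U n \<omega> v + replacement p (Z n \<omega>) v) \<in> borel_measurable M"
    by (rule measurable_cong) (simp add: U_update)
  ultimately show ?case by simp
qed

lemma (in color_urn) subalgebra_urn_history: "subalgebra M (urn_history M U n)"
proof -
  have "U i \<in> measurable M (\<Pi>\<^sub>M v\<in>(UNIV :: int set). (borel :: real measure))" for i
    by (rule measurable_PiM_single') (auto simp: U_component_measurable)
  then have "(\<lambda>\<omega>. \<lambda>i\<in>{..n}. U i \<omega>) \<in>
      measurable M (\<Pi>\<^sub>M i\<in>{..n}. \<Pi>\<^sub>M v\<in>(UNIV :: int set). (borel :: real measure))"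
    by (intro measurable_restrict)
  then show ?thesis
    unfolding subalgebra_def urn_history_def
    using sets_image_in_sets[OF refl] by simp
qed

definition walk_lattice :: "nat \<Rightarrow> real set" where
  "walk_lattice n = {real_of_int z / sqrt (ln (real n)) | z. True}"

end

theory Submission
  imports Defs
begin

text \<open>
  The colour \<open>Z n\<close> behaves like the simple random walk observed at an independent random time
  whose mean is about \<open>ln n\<close>. This is seen on characteristic functions. Taking expectations in
  the urn dynamics shows that \<open>q n v = P (Z n = v)\<close> solves the linear recursion
  \<open>(n + 2) q (n + 1) v = (n + 1) q n v + (q n (v - 1) + q n (v + 1)) / 2\<close>
  with \<open>q 0\<close> the initial configuration (\<open>prob_color_0\<close> and \<open>prob_color_Suc\<close>). On the Fourier
  side one step is multiplication by \<open>1 - (1 - cos t) / (n + 2)\<close>, so \<open>Z n\<close> started from a single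
  ball of colour 0 has characteristic function \<open>urn_char n\<close>, the product of these factors. A
  general initial configuration is a finite mixture of translates (\<open>prob_color_eq_kernel\<close>).

  Since the harmonic numbers grow like the logarithm, the product is essentially
  \<open>exp (- (1 - cos t) * ln n)\<close>. Two consequences carry the proof. At \<open>t = s / sqrt (ln n)\<close> it
  tends to \<open>exp (- s^2 / 2)\<close> (\<open>urn_char_scaled\<close>). On the whole period \<open>[-pi, pi]\<close> it is at most a
  constant times \<open>exp (- t^2 * ln n / 18)\<close> (\<open>scaled_char_bound\<close>). Here the point \<open>t = pi\<close> is
  harmless, unlike for the simple walk itself, whose parity is deterministic: the random time mixes
  both parities, and since \<open>1 - cos pi = 2\<close> the first factor of the product even vanishes there.

  Fourier inversion, with the density \<open>std_normal_density\<close> written as the inverse transform of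
  \<open>exp (- s^2 / 2)\<close>, bounds the local error at every lattice point by one and the same quantity,
  the \<open>L1\<close> distance of the rescaled characteristic function from the Gaussian
  (\<open>urn_kernel_local_limit\<close>). This distance tends to zero by dominated convergence. Translating
  by a colour \<open>w\<close> of the initial configuration costs at most \<open>\<bar>w\<bar> / sqrt (ln n)\<close>, because the
  Gaussian density is Lipschitz.
\<close>

section \<open>The Gaussian density and its Fourier transform\<close>

lemma gaussian_integrable: "integrable lborel (\<lambda>s::real. exp (- s\<^sup>2 / 18))"
proof -
  have "integrable lborel (\<lambda>s. sqrt (18 * pi) * normal_density 0 3 s)"
    by (rule integrable_mult_right) (simp add: integrable_normal_density)
  also have "(\<lambda>s. sqrt (18 * pi) * normal_density 0 3 s) = (\<lambda>s. exp (- s\<^sup>2 / 18))"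
    by (simp add: normal_density_def fun_eq_iff)
  finally show ?thesis .
qed

text \<open>The Gaussian is its own Fourier transform up to scaling, so its characteristic function
  read with the roles of time and frequency exchanged is an inversion formula.\<close>

lemma std_normal_density_fourier:
  "std_normal_density x = 1 / (2 * pi) * (\<integral>s. cos (s * x) * exp (- s\<^sup>2 / 2) \<partial>lborel)"
proof -
  interpret real_distribution std_normal_distribution
    by (rule real_dist_normal_dist)
  have "exp (- x\<^sup>2 / 2) = Re (char std_normal_distribution x)"
    by (simp add: char_std_normal_distribution)
  also have "\<dots> = (\<integral>s. Re (iexp (x * s)) \<partial>std_normal_distribution)"
    unfolding char_def by (rule integral_Re[symmetric]) (rule integrable_iexp, simp_all)
  also have "\<dots> = (\<integral>s. std_normal_density s * cos (x * s) \<partial>lborel)"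
    by (subst integral_density) (auto simp: Re_exp)
  also have "\<dots> = (\<integral>s. 1 / sqrt (2 * pi) * (cos (s * x) * exp (- s\<^sup>2 / 2)) \<partial>lborel)"
    by (simp add: std_normal_density_def mult.commute)
  also have "\<dots> = 1 / sqrt (2 * pi) * (\<integral>s. cos (s * x) * exp (- s\<^sup>2 / 2) \<partial>lborel)"
    by (rule integral_mult_right_zero)
  finally show ?thesis
    by (simp add: std_normal_density_def)
qed

text \<open>The derivative \<open>- x * std_normal_density x\<close> is bounded by 1 because
  \<open>\<bar>x\<bar> \<le> 1 + x^2 / 2 \<le> exp (x^2 / 2)\<close>.\<close>

lemma std_normal_density_lipschitz: "\<bar>std_normal_density x - std_normal_density y\<bar> \<le> \<bar>x - y\<bar>"
proof -
  have deriv: "(std_normal_density has_real_derivative - x * std_normal_density x) (at x within UNIV)" for x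
    unfolding std_normal_density_def[abs_def]
    by (rule derivative_eq_intros refl | simp add: power2_eq_square)+
  have bound: "norm (- x * std_normal_density x) \<le> 1" for x
  proof -
    have "\<bar>x\<bar> \<le> 1 + x\<^sup>2 / 2"
      using zero_le_power2[of "\<bar>x\<bar> - 1"] by (simp add: power2_eq_square algebra_simps)
    also have "\<dots> \<le> exp (x\<^sup>2 / 2)"
      by (rule exp_ge_add_one_self)
    finally have "\<bar>x\<bar> * exp (- x\<^sup>2 / 2) \<le> 1"
      by (simp add: exp_minus field_simps)
    moreover have "1 / sqrt (2 * pi) \<le> 1"
      using pi_ge_two by simp
    ultimately have "1 / sqrt (2 * pi) * (\<bar>x\<bar> * exp (- x\<^sup>2 / 2)) \<le> 1 * 1"
      by (intro mult_mono) auto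
    then show ?thesis
      by (simp add: std_normal_density_def abs_mult)
  qed
  have "norm (std_normal_density x - std_normal_density y) \<le> 1 * norm (x - y)"
    by (rule field_differentiable_bound[where S = UNIV, OF _ deriv bound]) auto
  then show ?thesis by simp
qed

section \<open>The urn started from a single ball of colour zero\<close>

text \<open>The characteristic function of \<open>Z n\<close> when the initial ball has colour 0: the factor with
  index \<open>k\<close> is \<open>(k + cos t) / (k + 1)\<close>, the effect of adding the \<open>k\<close>-th row to the urn. It is
  real because the walk is symmetric.\<close>

definition urn_char :: "nat \<Rightarrow> real \<Rightarrow> real" where
  "urn_char n t = (\<Prod>k=1..n. 1 - (1 - cos t) / (real k + 1))"

text \<open>Fourier inversion of \<open>urn_char n\<close>: the probability that \<open>Z n = z\<close> for this urn.\<close>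

definition urn_kernel :: "nat \<Rightarrow> int \<Rightarrow> real" where
  "urn_kernel n z =
     1 / (2 * pi) * (\<integral>t. indicator {-pi..pi} t * (cos (t * real_of_int z) * urn_char n t) \<partial>lborel)"

lemma urn_char_Suc: "(real n + 2) * urn_char (Suc n) t = (real n + 1 + cos t) * urn_char n t"
proof -
  have "urn_char (Suc n) t = urn_char n t * (1 - (1 - cos t) / (real n + 2))"
    by (simp add: urn_char_def add.commute)
  then show ?thesis
    by (simp add: field_simps)
qed

lemma continuous_urn_char: "continuous_on UNIV (urn_char n)"
  unfolding urn_char_def[abs_def] by (intro continuous_intros) auto

lemma urn_char_measurable [measurable]: "urn_char n \<in> borel_measurable borel"
  by (intro borel_measurable_continuous_onI continuous_urn_char)

lemma urn_kernel_integrable: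
  "integrable lborel (\<lambda>t. indicator {-pi..pi} t * (cos (t * z) * urn_char n t))"
proof -
  have "integrable lborel (\<lambda>t. indicator {-pi..pi} t *\<^sub>R (cos (t * z) * urn_char n t))"
    by (rule borel_integrable_compact)
      (auto intro!: continuous_intros continuous_on_subset[OF continuous_urn_char])
  then show ?thesis by simp
qed

lemma urn_kernel_0: "urn_kernel 0 z = (if z = 0 then 1 else 0)"
proof (cases "z = 0")
  case True
  then show ?thesis
    by (simp add: urn_kernel_def urn_char_def)
next
  case False
  have "(\<integral>t. cos (t * real_of_int z) * indicator {-pi..pi} t \<partial>lborel)
      = sin (pi * real_of_int z) / real_of_int z - sin (- pi * real_of_int z) / real_of_int z"
    using False
    by (intro integral_FTC_Icc_real[where F = "\<lambda>t. sin (t * real_of_int z) / real_of_int z"])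
      (auto intro!: derivative_eq_intros continuous_intros)
  also have "\<dots> = 0"
    by (simp add: sin_times_pi_eq_0 mult.commute)
  finally show ?thesis
    using False by (simp add: urn_kernel_def urn_char_def mult.commute)
qed

text \<open>Multiplication by \<open>cos t\<close> on the Fourier side is averaging over the two neighbours, since
  \<open>2 * cos (t * z) * cos t = cos (t * (z - 1)) + cos (t * (z + 1))\<close>.\<close>

lemma urn_kernel_Suc:
  "(real n + 2) * urn_kernel (Suc n) z
     = (real n + 1) * urn_kernel n z + (urn_kernel n (z - 1) + urn_kernel n (z + 1)) / 2"
proof -
  let ?I = "\<lambda>n z. \<integral>t. indicator {-pi..pi} t * (cos (t * real_of_int z) * urn_char n t) \<partial>lborel"
  have "(real n + 2) * ?I (Suc n) z
      = (\<integral>t. (real n + 2) * (indicator {-pi..pi} t * (cos (t * real_of_int z) * urn_char (Suc n) t)) \<partial>lborel)"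
    by simp
  also have "\<dots> = (\<integral>t. (real n + 1) * (indicator {-pi..pi} t * (cos (t * real_of_int z) * urn_char n t))
      + (1 / 2 * (indicator {-pi..pi} t * (cos (t * real_of_int (z - 1)) * urn_char n t))
       + 1 / 2 * (indicator {-pi..pi} t * (cos (t * real_of_int (z + 1)) * urn_char n t))) \<partial>lborel)"
  proof (rule Bochner_Integration.integral_cong[OF refl])
    fix t :: real
    have "cos (t * real_of_int (z - 1)) + cos (t * real_of_int (z + 1)) = 2 * (cos (t * real_of_int z) * cos t)"
      by (simp add: algebra_simps cos_add cos_diff)
    then have c: "cos (t * real_of_int z) * cos t =
        1 / 2 * cos (t * real_of_int (z - 1)) + 1 / 2 * cos (t * real_of_int (z + 1))"
      by simp
    have "(real n + 2) * (indicator {-pi..pi} t * (cos (t * real_of_int z) * urn_char (Suc n) t))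
        = indicator {-pi..pi} t * cos (t * real_of_int z) * ((real n + 2) * urn_char (Suc n) t)"
      by (simp only: ac_simps)
    also have "\<dots> = (real n + 1) * (indicator {-pi..pi} t * (cos (t * real_of_int z) * urn_char n t))
        + indicator {-pi..pi} t * ((cos (t * real_of_int z) * cos t) * urn_char n t)"
      unfolding urn_char_Suc by (simp only: algebra_simps)
    finally show "(real n + 2) * (indicator {-pi..pi} t * (cos (t * real_of_int z) * urn_char (Suc n) t)) =
      (real n + 1) * (indicator {-pi..pi} t * (cos (t * real_of_int z) * urn_char n t))
      + (1 / 2 * (indicator {-pi..pi} t * (cos (t * real_of_int (z - 1)) * urn_char n t))
       + 1 / 2 * (indicator {-pi..pi} t * (cos (t * real_of_int (z + 1)) * urn_char n t)))"
      unfolding c by (simp only: algebra_simps)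
  qed
  also have "\<dots> = (real n + 1) * ?I n z + (1 / 2 * ?I n (z - 1) + 1 / 2 * ?I n (z + 1))"
    by (simp only: Bochner_Integration.integral_add Bochner_Integration.integrable_add
        integrable_mult_right urn_kernel_integrable integral_mult_right_zero)
  finally have eq: "(real n + 2) * ?I (Suc n) z
      = (real n + 1) * ?I n z + (1 / 2 * ?I n (z - 1) + 1 / 2 * ?I n (z + 1))" .
  have "(real n + 2) * urn_kernel (Suc n) z = 1 / (2 * pi) * ((real n + 2) * ?I (Suc n) z)"
    unfolding urn_kernel_def by (simp only: ac_simps)
  also have "\<dots> = (real n + 1) * (1 / (2 * pi) * ?I n z)
     + (1 / (2 * pi) * ?I n (z - 1) + 1 / (2 * pi) * ?I n (z + 1)) / 2"
    unfolding eq by (simp add: field_simps)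
  finally show ?thesis
    unfolding urn_kernel_def .
qed

section \<open>Asymptotics of the characteristic function\<close>

lemma harm_Suc_minus_1: "(\<Sum>k=1..n. 1 / (real k + 1)) = harm (Suc n) - 1"
proof (induction n)
  case 0
  show ?case by (simp add: harm_def)
next
  case (Suc n)
  have "(\<Sum>k=1..Suc n. 1 / (real k + 1)) = (\<Sum>k=1..n. 1 / (real k + 1)) + inverse (real (Suc (Suc n)))"
    by (simp add: inverse_eq_divide add.commute)
  then show ?case
    using Suc by (simp only: harm_Suc[of "Suc n"])
qed

text \<open>A quadratic lower bound that holds up to the end points of the period. With
  \<open>1 - cos t = 2 * (sin (t / 2))^2\<close> it is enough that \<open>\<bar>sin u\<bar> \<ge> \<bar>u\<bar> / 3\<close> for \<open>\<bar>u\<bar> \<le> 2\<close>, which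
  follows from the cubic Taylor bound for the sine and leaves the constant \<open>2 / (3 * 2)^2 = 1 / 18\<close>.\<close>

lemma one_minus_cos_lower:
  assumes "\<bar>t\<bar> \<le> pi"
  shows "t\<^sup>2 / 18 \<le> 1 - cos t"
proof -
  define u where "u = t / 2"
  have u: "\<bar>u\<bar> \<le> 2"
    using assms pi_less_4 by (simp add: u_def)
  have "\<bar>sin u - u\<bar> \<le> \<bar>u\<bar> ^ 3 / 6"
    using Maclaurin_sin_bound[of u 3]
    by (simp add: numeral_3_eq_3 sin_coeff_def fact_numeral field_simps)
  also have "\<bar>u\<bar> ^ 3 / 6 = \<bar>u\<bar> * (u\<^sup>2 / 6)"
    by (simp add: power3_eq_cube power2_eq_square)
  also have "\<dots> \<le> \<bar>u\<bar> * (2 / 3)"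
  proof (rule mult_left_mono)
    have "u\<^sup>2 \<le> 2\<^sup>2"
      using u by (subst abs_le_square_iff[symmetric]) simp
    then show "u\<^sup>2 / 6 \<le> 2 / 3" by simp
  qed simp
  finally have "\<bar>u / 3\<bar> \<le> \<bar>sin u\<bar>"
    by (simp add: abs_if split: if_splits)
  then have "(u / 3)\<^sup>2 \<le> (sin u)\<^sup>2"
    by (simp only: abs_le_square_iff)
  moreover have "cos t = 1 - 2 * (sin u)\<^sup>2"
    using cos_double_sin[of u] by (simp add: u_def)
  ultimately show ?thesis
    by (simp add: u_def power2_eq_square)
qed

text \<open>Every factor lies between 0 and \<open>exp (- d / (k + 1))\<close>; the upper limit 2 for \<open>d\<close> is what keeps
  the factor with \<open>k = 1\<close> nonnegative.\<close>

lemma prod_le_exp_harm: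
  fixes d :: real
  assumes "0 \<le> d" "d \<le> 2"
  shows "(\<Prod>k=1..n. 1 - d / (real k + 1)) \<le> exp (- d * (harm (Suc n) - 1))"
    and "0 \<le> (\<Prod>k=1..n. 1 - d / (real k + 1))"
proof -
  have nonneg: "0 \<le> 1 - d / (real k + 1)" if "k \<in> {1..n}" for k
    using assms that by (simp add: field_simps)
  have "(\<Prod>k=1..n. 1 - d / (real k + 1)) \<le> (\<Prod>k=1..n. exp (- (d / (real k + 1))))"
  proof (rule prod_mono)
    fix k assume "k \<in> {1..n}"
    then show "0 \<le> 1 - d / (real k + 1) \<and> 1 - d / (real k + 1) \<le> exp (- (d / (real k + 1)))"
      using nonneg[of k] exp_ge_add_one_self[of "- (d / (real k + 1))"] by simp
  qed
  also have "\<dots> = exp (- d * (harm (Suc n) - 1))"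
    unfolding harm_Suc_minus_1[symmetric] by (simp add: exp_sum[symmetric] sum_distrib_left sum_negf)
  finally show "(\<Prod>k=1..n. 1 - d / (real k + 1)) \<le> exp (- d * (harm (Suc n) - 1))" .
  show "0 \<le> (\<Prod>k=1..n. 1 - d / (real k + 1))"
    using nonneg by (intro prod_nonneg) auto
qed

text \<open>The matching lower bound uses \<open>- x - 2 * x^2 \<le> ln (1 - x)\<close> for \<open>x \<le> 1 / 2\<close>. Replacing
  \<open>(k + 1)^2\<close> by \<open>k + 1\<close> in the quadratic term keeps everything in terms of harmonic numbers; the
  loss disappears in the limit when \<open>d\<close> is of order \<open>1 / ln n\<close>.\<close>

lemma exp_harm_le_prod:
  fixes d :: real
  assumes "0 \<le> d" "d \<le> 1"
  shows "exp (- (d + 2 * d\<^sup>2) * (harm (Suc n) - 1)) \<le> (\<Prod>k=1..n. 1 - d / (real k + 1))"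
proof -
  have "exp (- (d + 2 * d\<^sup>2) * (harm (Suc n) - 1))
      = (\<Prod>k=1..n. exp (- (d + 2 * d\<^sup>2) / (real k + 1)))"
    unfolding harm_Suc_minus_1[symmetric] by (simp add: exp_sum[symmetric] sum_distrib_left)
  also have "\<dots> \<le> (\<Prod>k=1..n. 1 - d / (real k + 1))"
  proof (rule prod_mono)
    fix k assume "k \<in> {1..n}"
    then have k: "1 \<le> k" by simp
    define x where "x = d / (real k + 1)"
    have x: "0 \<le> x" "x \<le> 1 / 2"
      using assms k by (auto simp: x_def field_simps)
    have "1 / (real k + 1) * (1 / (real k + 1)) \<le> 1 / (real k + 1) * 1"
      by (rule mult_left_mono) auto
    then have "d\<^sup>2 * (1 / (real k + 1) * (1 / (real k + 1))) \<le> d\<^sup>2 * (1 / (real k + 1) * 1)"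
      by (rule mult_left_mono) simp
    then have "x\<^sup>2 \<le> d\<^sup>2 / (real k + 1)"
      by (simp add: x_def power2_eq_square)
    then have "- (d + 2 * d\<^sup>2) / (real k + 1) \<le> - x - 2 * x\<^sup>2"
      by (simp add: x_def add_divide_distrib diff_divide_distrib)
    also have "\<dots> \<le> ln (1 - x)"
      using x by (rule ln_one_minus_pos_lower_bound)
    finally have "exp (- (d + 2 * d\<^sup>2) / (real k + 1)) \<le> exp (ln (1 - x))"
      by (simp only: exp_le_cancel_iff)
    also have "\<dots> = 1 - x"
      using x by simp
    finally have "exp (- (d + 2 * d\<^sup>2) / (real k + 1)) \<le> 1 - x" .
    then show "0 \<le> exp (- (d + 2 * d\<^sup>2) / (real k + 1))
        \<and> exp (- (d + 2 * d\<^sup>2) / (real k + 1)) \<le> 1 - d / (real k + 1)"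
      by (simp only: x_def exp_ge_zero)
  qed
  finally show ?thesis .
qed

text \<open>Uniform in \<open>t\<close>. The factor \<open>exp 2\<close> absorbs the term 1 in \<open>harm (Suc n) - 1\<close>, since
  \<open>1 - cos t \<le> 2\<close>.\<close>

lemma urn_char_bound:
  assumes "n \<ge> 1"
  shows "\<bar>urn_char n t\<bar> \<le> exp 2 * exp (- (1 - cos t) * ln (real n))"
proof -
  let ?d = "1 - cos t"
  have d: "0 \<le> ?d" "?d \<le> 2"
    using cos_ge_minus_one[of t] cos_le_one[of t] by linarith+
  have "ln (real n) \<le> ln (real (Suc n) + 1)"
    using assms by simp
  also have "\<dots> \<le> harm (Suc n)"
    by (rule harm_ge_ln)
  finally have "?d * ln (real n) \<le> ?d * harm (Suc n)"
    using d by (intro mult_left_mono) auto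
  then have "- ?d * (harm (Suc n) - 1) \<le> 2 + - ?d * ln (real n)"
    using d by (simp add: algebra_simps)
  then have "exp (- ?d * (harm (Suc n) - 1)) \<le> exp 2 * exp (- ?d * ln (real n))"
    by (simp flip: exp_add)
  then show ?thesis
    using prod_le_exp_harm[OF d, of n] unfolding urn_char_def by linarith
qed

lemma ln_nat_at_top: "filterlim (\<lambda>n. ln (real n)) at_top sequentially"
  by (rule filterlim_compose[OF ln_at_top filterlim_real_sequentially])

text \<open>The hypothesis forces \<open>d n\<close> to tend to 0. As \<open>harm n - ln n\<close> converges, the logarithm may
  be replaced by the harmonic number, and both bounds on the product have the limit
  \<open>exp (- a)\<close>.\<close>

lemma prod_tendsto_exp:
  fixes d :: "nat \<Rightarrow> real"
  assumes nonneg: "\<And>n. 0 \<le> d n" and lim: "(\<lambda>n. d n * ln (real n)) \<longlonglongrightarrow> a"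
  shows "(\<lambda>n. \<Prod>k=1..n. 1 - d n / (real k + 1)) \<longlonglongrightarrow> exp (- a)"
proof -
  have "(\<lambda>n. d n * ln (real n) * inverse (ln (real n))) \<longlonglongrightarrow> a * 0"
    by (intro tendsto_mult lim tendsto_inverse_0_at_top ln_nat_at_top)
  moreover have "\<forall>\<^sub>F n in sequentially. d n * ln (real n) * inverse (ln (real n)) = d n"
    using eventually_gt_at_top[of 1] by eventually_elim (auto simp: field_simps)
  ultimately have "d \<longlonglongrightarrow> a * 0"
    by (rule Lim_transform_eventually)
  then have d0: "d \<longlonglongrightarrow> 0" by simp
  have "(\<lambda>n. (harm n - ln (real n)) + inverse (real (Suc n)) - 1) \<longlonglongrightarrow> euler_mascheroni + 0 - 1"
    by (intro tendsto_intros euler_mascheroni_LIMSEQ LIMSEQ_inverse_real_of_nat)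
  then have "(\<lambda>n. d n * ln (real n) + d n * ((harm n - ln (real n)) + inverse (real (Suc n)) - 1))
      \<longlonglongrightarrow> a + 0 * (euler_mascheroni + 0 - 1)"
    by (intro tendsto_add tendsto_mult lim d0)
  then have h: "(\<lambda>n. d n * (harm (Suc n) - 1)) \<longlonglongrightarrow> a"
    by (simp add: harm_Suc algebra_simps)
  have upper: "(\<lambda>n. exp (- d n * (harm (Suc n) - 1))) \<longlonglongrightarrow> exp (- a)"
    using tendsto_exp[OF tendsto_minus[OF h]] by simp
  have "(\<lambda>n. exp (- ((1 + 2 * d n) * (d n * (harm (Suc n) - 1))))) \<longlonglongrightarrow> exp (- ((1 + 2 * 0) * a))"
    by (intro tendsto_intros h d0)
  then have lower: "(\<lambda>n. exp (- (d n + 2 * (d n)\<^sup>2) * (harm (Suc n) - 1))) \<longlonglongrightarrow> exp (- a)"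
    by (simp add: algebra_simps power2_eq_square)
  have small: "\<forall>\<^sub>F n in sequentially. d n < 1"
    using d0 by (rule order_tendstoD) simp
  show ?thesis
  proof (rule tendsto_sandwich[OF _ _ lower upper])
    show "\<forall>\<^sub>F n in sequentially. exp (- (d n + 2 * (d n)\<^sup>2) * (harm (Suc n) - 1))
        \<le> (\<Prod>k=1..n. 1 - d n / (real k + 1))"
      using small
    proof eventually_elim
      case (elim n)
      then show ?case
        using exp_harm_le_prod[OF nonneg[of n], of n] by simp
    qed
    show "\<forall>\<^sub>F n in sequentially. (\<Prod>k=1..n. 1 - d n / (real k + 1))
        \<le> exp (- d n * (harm (Suc n) - 1))"
      using small
    proof eventually_elim
      case (elim n)
      then show ?case
        using prod_le_exp_harm(1)[OF nonneg[of n], of n] by simp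
    qed
  qed
qed

lemma one_minus_cos_scaled:
  "(\<lambda>n. (1 - cos (s / sqrt (ln (real n)))) * ln (real n)) \<longlonglongrightarrow> s\<^sup>2 / 2"
proof -
  have taylor: "\<bar>1 - cos u - u\<^sup>2 / 2\<bar> \<le> u ^ 4 / 24" for u :: real
  proof -
    obtain t where "cos u = (\<Sum>m<4. cos_coeff m * u ^ m) + cos (t + 1 / 2 * real 4 * pi) / fact 4 * u ^ 4"
      using Maclaurin_cos_expansion[of u 4] by blast
    moreover have "{..<4} = {0, 1, 2, 3 :: nat}" by auto
    ultimately have "1 - cos u - u\<^sup>2 / 2 = - (cos (t + 2 * pi) * (u ^ 4 / 24))"
      by (simp add: cos_coeff_def fact_numeral)
    then have "\<bar>1 - cos u - u\<^sup>2 / 2\<bar> = \<bar>cos (t + 2 * pi)\<bar> * (u ^ 4 / 24)"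
      by (simp add: abs_mult)
    also have "\<dots> \<le> 1 * (u ^ 4 / 24)"
      by (intro mult_right_mono) auto
    finally show ?thesis by simp
  qed
  have "(\<lambda>n. (1 - cos (s / sqrt (ln (real n)))) * ln (real n) - s\<^sup>2 / 2) \<longlonglongrightarrow> 0"
  proof (rule Lim_null_comparison)
    have "(\<lambda>n. s ^ 4 / 24 * inverse (ln (real n))) \<longlonglongrightarrow> s ^ 4 / 24 * 0"
      by (intro tendsto_intros tendsto_inverse_0_at_top ln_nat_at_top)
    then show "(\<lambda>n. s ^ 4 / 24 * inverse (ln (real n))) \<longlonglongrightarrow> 0" by simp
    show "\<forall>\<^sub>F n in sequentially. norm ((1 - cos (s / sqrt (ln (real n)))) * ln (real n) - s\<^sup>2 / 2)
        \<le> s ^ 4 / 24 * inverse (ln (real n))"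
      using eventually_gt_at_top[of 1]
    proof eventually_elim
      case (elim n)
      define L where "L = ln (real n)"
      have L: "0 < L"
        using elim by (simp add: L_def)
      define u where "u = s / sqrt L"
      have u2: "u\<^sup>2 = s\<^sup>2 / L"
        using L by (simp add: u_def power_divide)
      have "u ^ 4 = (u\<^sup>2)\<^sup>2" by simp
      then have u4: "u ^ 4 = s ^ 4 / L\<^sup>2"
        unfolding u2 by (simp add: power_divide)
      have "(1 - cos u) * L - s\<^sup>2 / 2 = (1 - cos u - u\<^sup>2 / 2) * L"
        using L by (simp add: u2 field_simps)
      then have "\<bar>(1 - cos u) * L - s\<^sup>2 / 2\<bar> = \<bar>1 - cos u - u\<^sup>2 / 2\<bar> * L"
        using L by (simp add: abs_mult)
      also have "\<dots> \<le> u ^ 4 / 24 * L"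
        using taylor L by (intro mult_right_mono) auto
      also have "\<dots> = s ^ 4 / 24 * inverse L"
        using L by (simp add: u4 power2_eq_square field_simps)
      finally show ?case
        by (simp add: u_def L_def)
    qed
  qed
  then show ?thesis
    by (rule LIM_zero_cancel)
qed

lemma urn_char_scaled:
  "(\<lambda>n. urn_char n (s / sqrt (ln (real n)))) \<longlonglongrightarrow> exp (- s\<^sup>2 / 2)"
  unfolding urn_char_def using prod_tendsto_exp[OF _ one_minus_cos_scaled[of s]] by simp

section \<open>Local limit for the single-ball urn\<close>

text \<open>The substitution \<open>t = s / sqrt (ln n)\<close> turns the integral over one period into an integral
  over a growing interval; the cut-off is kept as an indicator so that all integrals are over
  the whole line.\<close>

definition scaled_char :: "nat \<Rightarrow> real \<Rightarrow> real" where
  "scaled_char n s =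
     indicator {-pi..pi} (s / sqrt (ln (real n))) * urn_char n (s / sqrt (ln (real n)))"

lemma scaled_char_measurable [measurable]: "scaled_char n \<in> borel_measurable borel"
  unfolding scaled_char_def[abs_def] by measurable

lemma scaled_char_bound:
  assumes "n \<ge> 2"
  shows "\<bar>scaled_char n s\<bar> \<le> exp 2 * exp (- s\<^sup>2 / 18)"
proof (cases "s / sqrt (ln (real n)) \<in> {-pi..pi}")
  case True
  define t where "t = s / sqrt (ln (real n))"
  have L: "0 < ln (real n)"
    using assms by simp
  have "t\<^sup>2 / 18 * ln (real n) \<le> (1 - cos t) * ln (real n)"
    using True L by (intro mult_right_mono one_minus_cos_lower) (auto simp: t_def)
  moreover have "t\<^sup>2 / 18 * ln (real n) = s\<^sup>2 / 18"
    using L by (simp add: t_def power_divide)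
  ultimately have "- (1 - cos t) * ln (real n) \<le> - s\<^sup>2 / 18"
    by linarith
  then have "exp 2 * exp (- (1 - cos t) * ln (real n)) \<le> exp 2 * exp (- s\<^sup>2 / 18)"
    by simp
  moreover have "\<bar>scaled_char n s\<bar> \<le> exp 2 * exp (- (1 - cos t) * ln (real n))"
    using urn_char_bound[of n t] assms True by (simp add: scaled_char_def t_def)
  ultimately show ?thesis by linarith
qed (simp add: scaled_char_def)

lemma scaled_char_tendsto: "(\<lambda>n. scaled_char n s) \<longlonglongrightarrow> exp (- s\<^sup>2 / 2)"
proof -
  have "(\<lambda>n. s / sqrt (ln (real n))) \<longlonglongrightarrow> 0"
    by (intro real_tendsto_divide_at_top[OF tendsto_const] filterlim_compose[OF sqrt_at_top ln_nat_at_top])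
  then have "\<forall>\<^sub>F n in sequentially. dist (s / sqrt (ln (real n))) 0 < pi"
    by (rule tendstoD) simp
  then have "\<forall>\<^sub>F n in sequentially. urn_char n (s / sqrt (ln (real n))) = scaled_char n s"
    by eventually_elim (simp add: scaled_char_def dist_real_def abs_less_iff del: abs_divide)
  then show ?thesis
    by (rule Lim_transform_eventually[OF urn_char_scaled])
qed

text \<open>The uniform bound on the local error: no lattice point appears in it.\<close>

definition scaled_char_error :: "nat \<Rightarrow> real" where
  "scaled_char_error n = 1 / (2 * pi) * (\<integral>s. \<bar>scaled_char n s - exp (- s\<^sup>2 / 2)\<bar> \<partial>lborel)"

lemma scaled_char_integrable:
  assumes "n \<ge> 2"
  shows "integrable lborel (scaled_char n)"
  by (rule Bochner_Integration.integrable_bound[OF integrable_mult_right[OF gaussian_integrable, of "exp 2"]])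
    (use scaled_char_bound[OF assms] in auto)

text \<open>Dominated convergence with a multiple of \<open>exp (- s^2 / 18)\<close>. The sequence is shifted by 2
  because the scale \<open>sqrt (ln n)\<close> is positive only from \<open>n = 2\<close> on.\<close>

lemma scaled_char_error_tendsto_0: "scaled_char_error \<longlonglongrightarrow> 0"
proof -
  let ?f = "\<lambda>n s. \<bar>scaled_char (n + 2) s - exp (- s\<^sup>2 / 2)\<bar>"
  let ?w = "\<lambda>s::real. (exp 2 + 1) * exp (- s\<^sup>2 / 18)"
  have "(\<lambda>n. \<integral>s. ?f n s \<partial>lborel) \<longlonglongrightarrow> (\<integral>s. 0 \<partial>(lborel :: real measure))"
  proof (rule integral_dominated_convergence[where w = ?w])
    show "integrable lborel ?w"
      by (intro integrable_mult_right gaussian_integrable)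
    show "AE s in lborel. (\<lambda>n. ?f n s) \<longlonglongrightarrow> 0"
    proof (rule AE_I2)
      fix s :: real
      have "(\<lambda>n. scaled_char (n + 2) s) \<longlonglongrightarrow> exp (- s\<^sup>2 / 2)"
        by (rule LIMSEQ_ignore_initial_segment[OF scaled_char_tendsto])
      then show "(\<lambda>n. ?f n s) \<longlonglongrightarrow> 0"
        by (intro tendsto_rabs_zero LIM_zero)
    qed
    show "AE s in lborel. norm (?f n s) \<le> ?w s" for n
    proof (rule AE_I2)
      fix s :: real
      have "exp (- s\<^sup>2 / 2) \<le> exp (- s\<^sup>2 / 18)" by simp
      then show "norm (?f n s) \<le> ?w s"
        using scaled_char_bound[of "n + 2" s] exp_ge_zero[of "- s\<^sup>2 / 2"]
        unfolding distrib_right real_norm_def by linarith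
    qed
  qed auto
  then have "(\<lambda>n. scaled_char_error (n + 2)) \<longlonglongrightarrow> 1 / (2 * pi) * 0"
    unfolding scaled_char_error_def by (intro tendsto_mult_left) simp
  then show ?thesis
    using LIMSEQ_offset[of scaled_char_error 2] by simp
qed

lemma half_gaussian_integrable: "integrable lborel (\<lambda>s::real. exp (- s\<^sup>2 / 2))"
  by (rule Bochner_Integration.integrable_bound[OF gaussian_integrable]) auto

lemma integrable_cos_mult:
  fixes f :: "real \<Rightarrow> real"
  assumes "integrable lborel f"
  shows "integrable lborel (\<lambda>s. cos (s * x) * f s)"
proof -
  have [measurable]: "f \<in> borel_measurable borel"
    using assms by auto
  show ?thesis
    by (rule Bochner_Integration.integrable_bound[OF assms])
      (auto simp: abs_mult intro!: AE_I2 mult_left_le_one_le)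
qed

text \<open>Both terms are Fourier integrals at the same frequency, so their difference is at most the
  integral of the absolute difference of the transforms, whatever the lattice point.\<close>

lemma urn_kernel_local_limit:
  assumes "n \<ge> 2"
  shows "\<bar>sqrt (ln (real n)) * urn_kernel n z - std_normal_density (real_of_int z / sqrt (ln (real n)))\<bar>
    \<le> scaled_char_error n"
proof -
  define r where "r = sqrt (ln (real n))"
  have r: "0 < r"
    using assms by (simp add: r_def)
  define x where "x = real_of_int z / r"
  let ?g = "\<lambda>s::real. exp (- s\<^sup>2 / 2)"
  have "r * (\<integral>t. indicator {-pi..pi} t * (cos (t * real_of_int z) * urn_char n t) \<partial>lborel)
      = r * (\<bar>1 / r\<bar> *\<^sub>R (\<integral>s. indicator {-pi..pi} (0 + 1 / r * s)
          * (cos ((0 + 1 / r * s) * real_of_int z) * urn_char n (0 + 1 / r * s)) \<partial>lborel))"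
    using r by (subst lborel_integral_real_affine[where c = "1 / r" and t = 0]) auto
  also have "\<dots> = (\<integral>s. cos (s * x) * scaled_char n s \<partial>lborel)"
    using r by (simp add: scaled_char_def r_def[symmetric] x_def mult_ac)
  finally have "r * urn_kernel n z = 1 / (2 * pi) * (\<integral>s. cos (s * x) * scaled_char n s \<partial>lborel)"
    unfolding urn_kernel_def by simp
  then have "r * urn_kernel n z - std_normal_density x
      = 1 / (2 * pi) * ((\<integral>s. cos (s * x) * scaled_char n s \<partial>lborel) - (\<integral>s. cos (s * x) * ?g s \<partial>lborel))"
    by (simp add: std_normal_density_fourier right_diff_distrib)
  also have "\<dots> = 1 / (2 * pi) * (\<integral>s. cos (s * x) * scaled_char n s - cos (s * x) * ?g s \<partial>lborel)"
    using scaled_char_integrable[OF assms] half_gaussian_integrable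
    by (subst Bochner_Integration.integral_diff) (auto intro: integrable_cos_mult)
  finally have "\<bar>r * urn_kernel n z - std_normal_density x\<bar>
      = 1 / (2 * pi) * \<bar>\<integral>s. cos (s * x) * scaled_char n s - cos (s * x) * ?g s \<partial>lborel\<bar>"
    by (simp add: abs_mult)
  also have "\<dots> \<le> scaled_char_error n"
    unfolding scaled_char_error_def
  proof (intro mult_left_mono)
    have "\<bar>\<integral>s. cos (s * x) * scaled_char n s - cos (s * x) * ?g s \<partial>lborel\<bar>
        \<le> (\<integral>s. \<bar>cos (s * x) * scaled_char n s - cos (s * x) * ?g s\<bar> \<partial>lborel)"
      by (rule integral_abs_bound)
    also have "\<dots> \<le> (\<integral>s. \<bar>scaled_char n s - ?g s\<bar> \<partial>lborel)"
    proof (rule integral_mono)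
      fix s :: real
      show "\<bar>cos (s * x) * scaled_char n s - cos (s * x) * ?g s\<bar> \<le> \<bar>scaled_char n s - ?g s\<bar>"
        unfolding right_diff_distrib[symmetric] abs_mult by (rule mult_left_le_one_le) auto
    qed (use scaled_char_integrable[OF assms] half_gaussian_integrable in
        \<open>auto intro!: integrable_abs Bochner_Integration.integrable_diff integrable_cos_mult\<close>)
    finally show "\<bar>\<integral>s. cos (s * x) * scaled_char n s - cos (s * x) * ?g s \<partial>lborel\<bar>
        \<le> (\<integral>s. \<bar>scaled_char n s - ?g s\<bar> \<partial>lborel)" .
  qed simp
  finally show ?thesis
    by (simp add: r_def x_def)
qed

section \<open>The law of the selected colour\<close>

context color_urn
begin

lemma color_event [measurable]: "{\<omega> \<in> space M. Z n \<omega> = v} \<in> events"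
  using measurable_sets[OF Z_measurable[of n], of "{v}"] by (simp add: vimage_def Int_def conj_commute)

lemma color_indicator_integrable:
  "integrable M (indicator {\<omega> \<in> space M. Z n \<omega> = v} :: 'a \<Rightarrow> real)"
  by (intro integrable_real_indicator color_event) (simp add: emeasure_eq_measure)

text \<open>The tower property applied to the conditional law of \<open>Z n\<close> given the history.\<close>

lemma prob_color:
  assumes "integrable M (\<lambda>\<omega>. U n \<omega> v)"
  shows "(real n + 1) * prob {\<omega> \<in> space M. Z n \<omega> = v} = expectation (\<lambda>\<omega>. U n \<omega> v)"
proof -
  interpret sigma_finite_subalgebra M "urn_history M U n"
    by (intro finite_measure_subalgebra_is_sigma_finite subalgebra_urn_history
        finite_measure_subalgebra.intro finite_measure_subalgebra_axioms.intro) unfold_locales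
  have "prob {\<omega> \<in> space M. Z n \<omega> = v} = expectation (indicator {\<omega> \<in> space M. Z n \<omega> = v})"
    using color_event[of n v] by simp
  also have "\<dots> = expectation (real_cond_exp M (urn_history M U n) (indicator {\<omega> \<in> space M. Z n \<omega> = v}))"
    by (intro real_cond_exp_int(2)[symmetric] color_indicator_integrable)
  also have "\<dots> = expectation (\<lambda>\<omega>. U n \<omega> v / (real n + 1))"
    using assms by (intro integral_cong_AE Z_cond) auto
  finally show ?thesis by simp
qed

end

locale simple_walk_urn = color_urn M p u\<^sub>0 U Z
  for M :: "'a measure" and p u\<^sub>0 U Z +
  assumes step: "p u = indicator {-1, 1} u / 2"
begin

lemma U_update_indicator:
  assumes "\<omega> \<in> space M"
  shows "U (Suc n) \<omega> v = U n \<omega> v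
    + (indicator {\<omega> \<in> space M. Z n \<omega> = v - 1} \<omega> + indicator {\<omega> \<in> space M. Z n \<omega> = v + 1} \<omega>) / 2"
  using assms by (auto simp: U_update replacement_def step indicator_def)

lemma U_integrable: "integrable M (\<lambda>\<omega>. U n \<omega> v)"
proof (induction n)
  case 0
  have "integrable M (\<lambda>\<omega>. U 0 \<omega> v) = integrable M (\<lambda>\<omega>. u\<^sub>0 v)"
    by (intro Bochner_Integration.integrable_cong) (auto simp: U_init)
  then show ?case by simp
next
  case (Suc n)
  have "integrable M (\<lambda>\<omega>. U (Suc n) \<omega> v) = integrable M (\<lambda>\<omega>. U n \<omega> v
    + (indicator {\<omega> \<in> space M. Z n \<omega> = v - 1} \<omega> + indicator {\<omega> \<in> space M. Z n \<omega> = v + 1} \<omega>) / 2)"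
    by (intro Bochner_Integration.integrable_cong U_update_indicator) auto
  also have "\<dots>"
    using Suc color_indicator_integrable
    by (intro Bochner_Integration.integrable_add integrable_divide_zero) auto
  finally show ?case by simp
qed

lemma prob_color_0: "prob {\<omega> \<in> space M. Z 0 \<omega> = v} = u\<^sub>0 v"
proof -
  have "expectation (\<lambda>\<omega>. U 0 \<omega> v) = expectation (\<lambda>\<omega>. u\<^sub>0 v)"
    by (intro Bochner_Integration.integral_cong) (auto simp: U_init)
  then show ?thesis
    using prob_color[OF U_integrable[of 0 v]] by (simp add: prob_space)
qed

lemma prob_color_Suc:
  "(real n + 2) * prob {\<omega> \<in> space M. Z (Suc n) \<omega> = v} = (real n + 1) * prob {\<omega> \<in> space M. Z n \<omega> = v}
    + (prob {\<omega> \<in> space M. Z n \<omega> = v - 1} + prob {\<omega> \<in> space M. Z n \<omega> = v + 1}) / 2"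
proof -
  have "(real n + 2) * prob {\<omega> \<in> space M. Z (Suc n) \<omega> = v} = expectation (\<lambda>\<omega>. U (Suc n) \<omega> v)"
    using prob_color[OF U_integrable[of "Suc n" v]] by (simp add: add.commute)
  also have "\<dots> = expectation (\<lambda>\<omega>. U n \<omega> v
    + (indicator {\<omega> \<in> space M. Z n \<omega> = v - 1} \<omega> + indicator {\<omega> \<in> space M. Z n \<omega> = v + 1} \<omega>) / 2)"
    by (intro Bochner_Integration.integral_cong U_update_indicator) auto
  also have "\<dots> = expectation (\<lambda>\<omega>. U n \<omega> v)
    + (prob {\<omega> \<in> space M. Z n \<omega> = v - 1} + prob {\<omega> \<in> space M. Z n \<omega> = v + 1}) / 2"
    using U_integrable color_indicator_integrable
    by (subst Bochner_Integration.integral_add) auto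
  finally show ?thesis
    unfolding prob_color[OF U_integrable, symmetric] .
qed

text \<open>Both sides solve the same linear recursion with the same initial values, the recursion being
  invariant under translation of the colours.\<close>

lemma prob_color_eq_kernel:
  "prob {\<omega> \<in> space M. Z n \<omega> = v} = (\<Sum>w | u\<^sub>0 w \<noteq> 0. u\<^sub>0 w * urn_kernel n (v - w))"
proof (induction n arbitrary: v)
  case 0
  have "(\<Sum>w | u\<^sub>0 w \<noteq> 0. u\<^sub>0 w * urn_kernel 0 (v - w)) = (\<Sum>w | u\<^sub>0 w \<noteq> 0. if w = v then u\<^sub>0 w else 0)"
    by (intro sum.cong) (auto simp: urn_kernel_0)
  also have "\<dots> = u\<^sub>0 v"
    using init_finite by simp
  finally show ?case
    by (simp add: prob_color_0)
next
  case (Suc n)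
  have shift: "v - 1 - w = v - w - 1" "v + 1 - w = v - w + 1" for w
    by simp_all
  have "(real n + 2) * prob {\<omega> \<in> space M. Z (Suc n) \<omega> = v}
      = (\<Sum>w | u\<^sub>0 w \<noteq> 0. u\<^sub>0 w * ((real n + 1) * urn_kernel n (v - w)
          + (urn_kernel n (v - w - 1) + urn_kernel n (v - w + 1)) / 2))"
    unfolding prob_color_Suc Suc shift sum_distrib_left sum_divide_distrib sum.distrib[symmetric]
    by (intro sum.cong refl) (simp add: distrib_left add_divide_distrib mult_ac)
  also have "\<dots> = (real n + 2) * (\<Sum>w | u\<^sub>0 w \<noteq> 0. u\<^sub>0 w * urn_kernel (Suc n) (v - w))"
    unfolding urn_kernel_Suc[symmetric] sum_distrib_left by (simp only: mult_ac)
  finally show ?case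
    by simp
qed

text \<open>As \<open>u\<^sub>0\<close> is a probability vector, the error is an average over the initial colours \<open>w\<close> of the
  single-ball error and the cost of moving the argument of the density by
  \<open>w / sqrt (ln n)\<close>.\<close>

lemma color_local_limit:
  assumes "n \<ge> 2"
  shows "\<bar>sqrt (ln (real n)) * prob {\<omega> \<in> space M. Z n \<omega> = v}
      - std_normal_density (real_of_int v / sqrt (ln (real n)))\<bar>
    \<le> scaled_char_error n + (\<Sum>w | u\<^sub>0 w \<noteq> 0. u\<^sub>0 w * \<bar>real_of_int w\<bar>) / sqrt (ln (real n))"
proof -
  define r where "r = sqrt (ln (real n))"
  have r: "0 < r"
    using assms by (simp add: r_def)
  let ?\<phi> = "\<lambda>z. std_normal_density (real_of_int z / r)"
  have "r * prob {\<omega> \<in> space M. Z n \<omega> = v} - ?\<phi> v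
      = (\<Sum>w | u\<^sub>0 w \<noteq> 0. u\<^sub>0 w * (r * urn_kernel n (v - w))) - (\<Sum>w | u\<^sub>0 w \<noteq> 0. u\<^sub>0 w) * ?\<phi> v"
    by (simp add: prob_color_eq_kernel init_sum sum_distrib_left mult_ac)
  also have "\<dots> = (\<Sum>w | u\<^sub>0 w \<noteq> 0. u\<^sub>0 w * (r * urn_kernel n (v - w) - ?\<phi> v))"
    by (simp add: sum_distrib_right sum_subtractf right_diff_distrib)
  finally have "\<bar>r * prob {\<omega> \<in> space M. Z n \<omega> = v} - ?\<phi> v\<bar>
      \<le> (\<Sum>w | u\<^sub>0 w \<noteq> 0. \<bar>u\<^sub>0 w * (r * urn_kernel n (v - w) - ?\<phi> v)\<bar>)"
    by (simp only: sum_abs)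
  also have "\<dots> \<le> (\<Sum>w | u\<^sub>0 w \<noteq> 0. u\<^sub>0 w * (scaled_char_error n + \<bar>real_of_int w\<bar> / r))"
  proof (rule sum_mono)
    fix w
    have "\<bar>?\<phi> (v - w) - ?\<phi> v\<bar> \<le> \<bar>real_of_int (v - w) / r - real_of_int v / r\<bar>"
      by (rule std_normal_density_lipschitz)
    also have "\<dots> = \<bar>real_of_int w\<bar> / r"
      using r by (simp add: diff_divide_distrib)
    finally have "\<bar>r * urn_kernel n (v - w) - ?\<phi> v\<bar> \<le> scaled_char_error n + \<bar>real_of_int w\<bar> / r"
      using urn_kernel_local_limit[OF assms, of "v - w"] unfolding r_def[symmetric] by linarith
    then show "\<bar>u\<^sub>0 w * (r * urn_kernel n (v - w) - ?\<phi> v)\<bar> \<le> u\<^sub>0 w * (scaled_char_error n + \<bar>real_of_int w\<bar> / r)"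
      using init_nonneg[of w] by (simp add: abs_mult mult_left_mono)
  qed
  also have "\<dots> = (\<Sum>w | u\<^sub>0 w \<noteq> 0. u\<^sub>0 w) * scaled_char_error n + (\<Sum>w | u\<^sub>0 w \<noteq> 0. u\<^sub>0 w * \<bar>real_of_int w\<bar>) / r"
    by (simp add: distrib_left sum.distrib sum_distrib_right sum_divide_distrib)
  finally show ?thesis
    by (simp add: init_sum r_def)
qed

end

text \<open>The two given atoms exhaust the total mass, so no other increment has positive probability.\<close>

lemma increment_pmf_simple:
  assumes "walk_increments N X"
    and "\<P>(\<omega> in N. X 1 \<omega> = 1) = 1 / 2"
    and "\<P>(\<omega> in N. X 1 \<omega> = -1) = 1 / 2"
  shows "increment_pmf N X u = indicator {-1, 1} u / 2"
proof -
  interpret walk_increments N X by fact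
  have X: "X 1 \<in> measurable N (count_space UNIV)"
    using indep by (auto simp: indep_vars_def)
  have ev: "{\<omega> \<in> space N. X 1 \<omega> = v} \<in> events" for v
    using measurable_sets[OF X, of "{v}"] by (simp add: vimage_def Int_def conj_commute)
  show ?thesis
  proof (cases "u \<in> {-1, 1}")
    case True
    then show ?thesis
      using assms(2,3) by (auto simp: increment_pmf_def)
  next
    case False
    let ?A = "{\<omega> \<in> space N. X 1 \<omega> = 1} \<union> {\<omega> \<in> space N. X 1 \<omega> = -1}"
    have "prob ?A = 1"
      using assms(2,3) ev by (subst finite_measure_Union) auto
    moreover have "prob (?A \<union> {\<omega> \<in> space N. X 1 \<omega> = u}) = prob ?A + prob {\<omega> \<in> space N. X 1 \<omega> = u}"
      using False ev by (intro finite_measure_Union) auto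
    ultimately have "prob {\<omega> \<in> space N. X 1 \<omega> = u} \<le> 0"
      using prob_le_1[of "?A \<union> {\<omega> \<in> space N. X 1 \<omega> = u}"] by linarith
    then have "prob {\<omega> \<in> space N. X 1 \<omega> = u} = 0"
      using measure_nonneg[of N "{\<omega> \<in> space N. X 1 \<omega> = u}"] by linarith
    then show ?thesis
      using False by (simp add: increment_pmf_def)
  qed
qed

theorem theorem6:
  fixes N :: "'b measure" and X :: "nat \<Rightarrow> 'b \<Rightarrow> int"
    and M :: "'a measure" and u\<^sub>0 :: "int \<Rightarrow> real"
    and U :: "nat \<Rightarrow> 'a \<Rightarrow> int \<Rightarrow> real" and Z :: "nat \<Rightarrow> 'a \<Rightarrow> int"
  assumes "walk_increments N X"
    and "color_urn M (increment_pmf N X) u\<^sub>0 U Z"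
    and "\<P>(\<omega> in N. X 1 \<omega> = 1) = 1 / 2"
    and "\<P>(\<omega> in N. X 1 \<omega> = -1) = 1 / 2"
  shows "(\<lambda>n. SUP x\<in>walk_lattice n.
      \<bar>sqrt (ln (real n)) * \<P>(\<omega> in M. real_of_int (Z n \<omega>) / sqrt (ln (real n)) = x)
        - std_normal_density x\<bar>) \<longlonglongrightarrow> 0"
proof -
  interpret simple_walk_urn M "increment_pmf N X" u\<^sub>0 U Z
    by (intro simple_walk_urn.intro simple_walk_urn_axioms.intro assms(2)
        increment_pmf_simple[OF assms(1,3,4)])
  let ?err = "\<lambda>n x. \<bar>sqrt (ln (real n)) * \<P>(\<omega> in M. real_of_int (Z n \<omega>) / sqrt (ln (real n)) = x)
        - std_normal_density x\<bar>"
  let ?D = "\<lambda>n. scaled_char_error n + (\<Sum>w | u\<^sub>0 w \<noteq> 0. u\<^sub>0 w * \<bar>real_of_int w\<bar>) / sqrt (ln (real n))"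
  have "?D \<longlonglongrightarrow> 0 + 0"
    by (intro tendsto_add scaled_char_error_tendsto_0 real_tendsto_divide_at_top[OF tendsto_const]
        filterlim_compose[OF sqrt_at_top ln_nat_at_top])
  then have D: "?D \<longlonglongrightarrow> 0" by simp
  have err: "?err n x \<le> ?D n" if n: "n \<ge> 2" and x: "x \<in> walk_lattice n" for n x
  proof -
    obtain z where x: "x = real_of_int z / sqrt (ln (real n))"
      using x unfolding walk_lattice_def by blast
    have "0 < sqrt (ln (real n))"
      using n by simp
    then have "real_of_int (Z n \<omega>) / sqrt (ln (real n)) = x \<longleftrightarrow> Z n \<omega> = z" for \<omega>
      by (simp add: x)
    then show ?thesis
      using color_local_limit[OF n, of z] by (simp add: x)
  qed
  have zero_in: "0 \<in> walk_lattice n" for n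
    by (auto simp: walk_lattice_def intro: exI[of _ 0])
  show ?thesis
  proof (rule tendsto_sandwich[OF _ _ tendsto_const D])
    show "\<forall>\<^sub>F n in sequentially. 0 \<le> (SUP x\<in>walk_lattice n. ?err n x)"
      using eventually_ge_at_top[of 2]
    proof eventually_elim
      case (elim n)
      have "0 \<le> ?err n 0" by simp
      also have "\<dots> \<le> (SUP x\<in>walk_lattice n. ?err n x)"
        using err[OF elim] zero_in by (intro cSUP_upper bdd_aboveI2[where M = "?D n"])
      finally show ?case .
    qed
    show "\<forall>\<^sub>F n in sequentially. (SUP x\<in>walk_lattice n. ?err n x) \<le> ?D n"
      using eventually_ge_at_top[of 2]
    proof eventually_elim
      case (elim n)
      show ?case
        using zero_in err[OF elim] by (intro cSUP_least) auto
    qed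
  qed
qed

end
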